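(* Let $G$ be a (non-empty) digraph with at most three vertices, marked by distinct elements of some subset of $\{s,ss,un\}$. Suppose that: (1) there is a loop at each vertex; (2) $G$ is weakly connected; (3) there are no ingoing edges at the vertex $un$ (from other vertices); (4) if $\{s,ss\}\subseteq V(G)$ then there is an edge $(s,ss)$; (5) if $ss\in V(G)$ then $s\in V(G)$. Then there exists a stability theory $S$ with $Adj(S)\cong G$, by an isomorphism sending marked vertices to the corresponding vertices of $Adj(S)$. Moreover, the adjacency digraph of every stability theory satisfies these conditions.
   Context: A stability theory $S=(\mathbb{CP}^1,\Omega,\infty)$ is given by a semialgebraic subset $\Omega$ of $\mathbb{CP}^1$ (viewed as a real algebraic variety); it stratifies $\mathbb{CP}^1$ into $\Omega_s=\Omega$, $\Omega_{ss}=\overline\Omega\setminus\Omega$, $\Omega_{un}=\mathbb{CP}^1\setminus\overline\Omega$ (Euclidean closure). The adjacency digraph $Adj(S)$ has as vertices the non-empty strata among $\Omega_s,\Omega_{ss},\Omega_{un}$, marked $s$, $ss$, $un$ respectively, and an edge $(i,j)$ iff $\overline{\Omega_i}\cap\Omega_j\ne\varnothing$. *)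

theory Defs
  imports "HOL-Analysis.Analysis" "Graph_Theory.Graph_Theory"
begin

section \<open>The complex projective line\<close>

definition proportional :: "complex \<times> complex \<Rightarrow> complex \<times> complex \<Rightarrow> bool" where
  "proportional v w \<longleftrightarrow>
     v \<noteq> 0 \<and> w \<noteq> 0 \<and> (\<exists>c. c \<noteq> 0 \<and> w = (c * fst v, c * snd v))"

text \<open>The relation is partial: only nonzero vectors are related, so \<open>(0, 0)\<close> represents no point.\<close>

quotient_type cp1 = "complex \<times> complex" / partial: proportional
proof (rule part_equivpI)
  show "\<exists>v. proportional v v"
    by (rule exI[of _ "(1, 0)"]) (auto simp: proportional_def zero_prod_def intro: exI[of _ 1])
  show "symp proportional"
  proof (rule sympI)
    fix v w assume "proportional v w"
    then obtain c where c: "v \<noteq> 0" "w \<noteq> 0" "c \<noteq> 0" "w = (c * fst v, c * snd v)"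
      by (auto simp: proportional_def)
    then have "v = (inverse c * fst w, inverse c * snd w)"
      by (simp add: prod_eq_iff field_simps)
    with c show "proportional w v"
      unfolding proportional_def by (metis nonzero_imp_inverse_nonzero)
  qed
  show "transp proportional"
  proof (rule transpI)
    fix u v w assume "proportional u v" "proportional v w"
    then obtain c d where "u \<noteq> 0" "w \<noteq> 0" "c \<noteq> 0" "d \<noteq> 0"
        "v = (c * fst u, c * snd u)" "w = (d * fst v, d * snd v)"
      by (auto simp: proportional_def)
    then show "proportional u w"
      unfolding proportional_def by (auto intro!: exI[of _ "d * c"])
  qed
qed

text \<open>\<open>hpoint a b\<close> is the point \<open>[a : b]\<close>; it is meaningful only for \<open>(a, b) \<noteq> (0, 0)\<close>.\<close>

definition hpoint :: "complex \<Rightarrow> complex \<Rightarrow> cp1" where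
  "hpoint a b = abs_cp1 (a, b)"

definition cp1_infinity :: cp1 where
  "cp1_infinity = hpoint 1 0"

text \<open>The Euclidean topology is the quotient topology of the punctured plane
  (which is open, so openness there is openness in the whole plane).\<close>

instantiation cp1 :: topological_space
begin

definition open_cp1 :: "cp1 set \<Rightarrow> bool" where
  "open_cp1 U \<longleftrightarrow> open {v. v \<noteq> 0 \<and> abs_cp1 v \<in> U}"

instance
proof
  have "{v::complex \<times> complex. v \<noteq> 0 \<and> abs_cp1 v \<in> UNIV} = - {0}" by auto
  then show "open (UNIV :: cp1 set)"
    unfolding open_cp1_def by (simp only: open_Compl closed_singleton)
next
  fix U V :: "cp1 set" assume "open U" "open V"
  moreover have "{v. v \<noteq> 0 \<and> abs_cp1 v \<in> U \<inter> V} =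
      {v. v \<noteq> 0 \<and> abs_cp1 v \<in> U} \<inter> {v. v \<noteq> 0 \<and> abs_cp1 v \<in> V}" by auto
  ultimately show "open (U \<inter> V)" unfolding open_cp1_def by auto
next
  fix K :: "cp1 set set" assume "\<forall>U\<in>K. open U"
  moreover have "{v. v \<noteq> 0 \<and> abs_cp1 v \<in> \<Union>K} =
      (\<Union>U\<in>K. {v. v \<noteq> 0 \<and> abs_cp1 v \<in> U})" by auto
  ultimately show "open (\<Union>K)" unfolding open_cp1_def by auto
qed

end

section \<open>Semialgebraic sets\<close>

text \<open>The least family containing the sets \<open>p > 0\<close>, for real polynomial functions \<open>p\<close>, and closed
  under finite Boolean operations. On \<open>complex\<close>, \<open>real_polynomial_function\<close> means polynomial in
  the real and imaginary parts.\<close>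

inductive semialgebraic :: "'a::euclidean_space set \<Rightarrow> bool" where
  semialgebraic_pos: "real_polynomial_function p \<Longrightarrow> semialgebraic {x. p x > 0}"
| semialgebraic_Compl: "semialgebraic A \<Longrightarrow> semialgebraic (- A)"
| semialgebraic_Int: "semialgebraic A \<Longrightarrow> semialgebraic B \<Longrightarrow> semialgebraic (A \<inter> B)"
| semialgebraic_Un: "semialgebraic A \<Longrightarrow> semialgebraic B \<Longrightarrow> semialgebraic (A \<union> B)"

text \<open>A subset of the projective line is semialgebraic when it is so in both standard affine
  charts, each identified with the real plane.\<close>

definition semialgebraic_cp1 :: "cp1 set \<Rightarrow> bool" where
  "semialgebraic_cp1 \<Omega> \<longleftrightarrow>
     semialgebraic {z. hpoint z 1 \<in> \<Omega>} \<and> semialgebraic {w. hpoint 1 w \<in> \<Omega>}"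

section \<open>Stability theories and their adjacency digraphs\<close>

record stability_data =
  ambient :: "cp1 set"
  stable_locus :: "cp1 set"
  base_point :: cp1

definition stability_theory :: "stability_data \<Rightarrow> bool" where
  "stability_theory S \<longleftrightarrow>
     ambient S = UNIV \<and> semialgebraic_cp1 (stable_locus S) \<and> base_point S = cp1_infinity"

datatype mark = Stab | Semistab | Unstab

fun stratum :: "stability_data \<Rightarrow> mark \<Rightarrow> cp1 set" where
  "stratum S Stab = stable_locus S"
| "stratum S Semistab = closure (stable_locus S) - stable_locus S"
| "stratum S Unstab = ambient S - closure (stable_locus S)"

definition adj :: "stability_data \<Rightarrow> cp1 set pair_pre_digraph" where
  "adj S = \<lparr> pverts = {stratum S i | i. stratum S i \<noteq> {}},
     parcs = {(stratum S i, stratum S j) | i j.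
       stratum S i \<noteq> {} \<and> stratum S j \<noteq> {} \<and> closure (stratum S i) \<inter> stratum S j \<noteq> {}} \<rparr>"

definition adj_mark :: "stability_data \<Rightarrow> cp1 set \<Rightarrow> mark" where
  "adj_mark S X = (THE i. stratum S i = X)"

text \<open>The strata are pairwise disjoint, so the mark of a vertex is uniquely determined.\<close>

lemma stratum_disjoint: "i \<noteq> j \<Longrightarrow> stratum S i \<inter> stratum S j = {}"
  using closure_subset[of "stable_locus S"] by (cases i; cases j) auto

lemma adj_mark_stratum: "stratum S i \<noteq> {} \<Longrightarrow> adj_mark S (stratum S i) = i"
  unfolding adj_mark_def by (rule the_equality) (use stratum_disjoint in fastforce)+

section \<open>Marked digraphs\<close>

definition marked_digraph :: "'v pair_pre_digraph \<Rightarrow> ('v \<Rightarrow> mark) \<Rightarrow> bool" where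
  "marked_digraph G \<mu> \<longleftrightarrow>
     pair_fin_digraph G \<and> pverts G \<noteq> {} \<and> card (pverts G) \<le> 3 \<and> inj_on \<mu> (pverts G)"

definition adjacency_conditions :: "'v pair_pre_digraph \<Rightarrow> ('v \<Rightarrow> mark) \<Rightarrow> bool" where
  "adjacency_conditions G \<mu> \<longleftrightarrow>
     (\<forall>v\<in>pverts G. (v, v) \<in> parcs G) \<and>
     Digraph_Component.connected (with_proj G) \<and>
     (\<forall>u v. (u, v) \<in> parcs G \<and> \<mu> v = Unstab \<longrightarrow> u = v) \<and>
     (\<forall>u\<in>pverts G. \<forall>v\<in>pverts G. \<mu> u = Stab \<and> \<mu> v = Semistab \<longrightarrow> (u, v) \<in> parcs G) \<and>
     (Semistab \<in> \<mu> ` pverts G \<longrightarrow> Stab \<in> \<mu> ` pverts G)"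

text \<open>This is \<open>digraph_iso\<close> with the additional requirement that the vertex map preserves marks;
  \<open>Digraph_Component.connected\<close> above is weak connectedness.\<close>

definition marked_digraph_iso ::
    "'v pair_pre_digraph \<Rightarrow> ('v \<Rightarrow> mark) \<Rightarrow> 'w pair_pre_digraph \<Rightarrow> ('w \<Rightarrow> mark) \<Rightarrow> bool" where
  "marked_digraph_iso G \<mu> H \<nu> \<longleftrightarrow>
     (\<exists>f. pre_digraph.digraph_isomorphism (with_proj G) f \<and>
          with_proj H = app_iso f (with_proj G) \<and>
          (\<forall>v\<in>pverts G. \<nu> (iso_verts f v) = \<mu> v))"

end

theory Submission
  imports Defs
begin

text \<open>
  Write \<open>touches S i j\<close> when the closure of the stratum marked \<open>i\<close> meets the one marked \<open>j\<close>.

  \<^bold>\<open>Necessity.\<close> The closures of the stable and the semistable stratum both lie in the closure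
  of \<open>\<Omega>\<close>, so neither meets the unstable stratum, while the closure of \<open>\<Omega>\<close> contains the whole
  semistable stratum. The only condition with topological content is weak connectedness: the
  projective line is connected, so the closures of the unstable stratum and of \<open>\<Omega>\<close>, which are
  closed and cover it, intersect when both are nonempty (lemma \<open>Unstab_touches_rest\<close>). Hence the
  unstable vertex is joined to one of the other two, and those two are always adjacent.

  \<^bold>\<open>Sufficiency.\<close> Given the vertex set, the conditions leave only the arcs \<open>(ss, s)\<close>, \<open>(un, s)\<close>
  and \<open>(un, ss)\<close> undecided, and at least one of the last two is present if \<open>un\<close> and \<open>s\<close> are
  both vertices (lemma \<open>touches_determined\<close>). If \<open>un\<close> and \<open>s\<close> are both
  vertices, every admissible pattern is realized by removing from the closed unit disc of the
  affine chart a set \<open>P \<union> Q\<close> with dense complement, which then becomes the semistable stratum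
  (both parts are empty if \<open>ss\<close> is not a vertex). The two parts act independently.

  \<^item> \<open>P\<close> lies inside the open disc and decides \<open>(ss, s)\<close>: it is the single point \<open>0\<close>, which is
    closed, or the open segment from \<open>0\<close> to \<open>1 / 2\<close>, which accumulates at the stable point \<open>0\<close>.
  \<^item> \<open>Q\<close> lies on the unit circle, which is where the closure of the unstable exterior meets the
    disc. Taking \<open>Q\<close> to be the whole circle, one point, or empty makes the unstable stratum touch
    only the semistable stratum, both strata, or only the stable one.

  Without an unstable vertex, the complement of \<open>P\<close> in the whole projective line does the same
  job; and if \<open>un\<close> is the only vertex, then \<open>\<Omega> = {}\<close>.
\<close>

section \<open>Charts and topology of the projective line\<close>

abbreviation affine_pt :: "complex \<Rightarrow> cp1" where
  "affine_pt z \<equiv> hpoint z 1"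

abbreviation coaffine_pt :: "complex \<Rightarrow> cp1" where
  "coaffine_pt w \<equiv> hpoint 1 w"

lemma proportional_refl: "v \<noteq> 0 \<Longrightarrow> proportional v v"
  unfolding proportional_def by (auto intro: exI[of _ 1])

text \<open>The quotient is partial, so equality of classes reduces to proportionality only for vectors in
  the domain of the relation, that is, for nonzero ones.\<close>

lemma abs_cp1_eq_iff:
  assumes "v \<noteq> 0" "w \<noteq> 0"
  shows "abs_cp1 v = abs_cp1 w \<longleftrightarrow> proportional v w"
  using Quotient3_rel[OF Quotient3_cp1, of v w] proportional_refl assms by blast

lemma abs_cp1_affine:
  assumes "b \<noteq> 0"
  shows "abs_cp1 (a, b) = affine_pt (a / b)"
  using assms unfolding hpoint_def
  by (subst abs_cp1_eq_iff)
    (auto simp: proportional_def zero_prod_def field_simps intro!: exI[of _ "inverse b"])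

lemma abs_cp1_coaffine:
  assumes "a \<noteq> 0"
  shows "abs_cp1 (a, b) = coaffine_pt (b / a)"
  using assms unfolding hpoint_def
  by (subst abs_cp1_eq_iff)
    (auto simp: proportional_def zero_prod_def field_simps intro!: exI[of _ "inverse a"])

lemma coaffine_pt_eq_affine_pt: "w \<noteq> 0 \<Longrightarrow> coaffine_pt w = affine_pt (inverse w)"
  using abs_cp1_affine[of w 1] by (simp add: hpoint_def inverse_eq_divide)

lemma affine_pt_eq_iff [simp]: "affine_pt z = affine_pt z' \<longleftrightarrow> z = z'"
  unfolding hpoint_def by (subst abs_cp1_eq_iff) (auto simp: proportional_def zero_prod_def)

lemma coaffine_pt_eq_iff [simp]: "coaffine_pt w = coaffine_pt w' \<longleftrightarrow> w = w'"
  unfolding hpoint_def by (subst abs_cp1_eq_iff) (auto simp: proportional_def zero_prod_def)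

lemma coaffine_pt_0_neq_affine_pt [simp]:
  "coaffine_pt 0 \<noteq> affine_pt z"
  "affine_pt z \<noteq> coaffine_pt 0"
  unfolding hpoint_def by (subst abs_cp1_eq_iff; auto simp: proportional_def zero_prod_def)+

lemma cp1_cases:
  obtains (affine) z where "p = affine_pt z" | (infinity) "p = coaffine_pt 0"
proof -
  have "proportional (rep_cp1 p) (rep_cp1 p)" and eq: "abs_cp1 (rep_cp1 p) = p"
    using Quotient3_rep_reflp[OF Quotient3_cp1] Quotient3_abs_rep[OF Quotient3_cp1] by auto
  then have nz: "rep_cp1 p \<noteq> 0" by (simp add: proportional_def)
  obtain a b where ab: "rep_cp1 p = (a, b)" by (cases "rep_cp1 p")
  show thesis
  proof (cases "b = 0")
    case True
    with nz ab have "a \<noteq> 0" by (simp add: zero_prod_def)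
    with True show thesis using eq ab abs_cp1_coaffine[of a b] infinity by simp
  next
    case False
    with eq ab abs_cp1_affine[of b a] affine[of "a / b"] show thesis by simp
  qed
qed

lemma coaffine_pt_in_affine_image_iff:
  "coaffine_pt w \<in> affine_pt ` A \<longleftrightarrow> w \<noteq> 0 \<and> inverse w \<in> A"
  by (cases "w = 0") (auto simp: coaffine_pt_eq_affine_pt)

lemma affine_pt_in_coaffine_image_iff:
  "affine_pt z \<in> coaffine_pt ` A \<longleftrightarrow> z \<noteq> 0 \<and> inverse z \<in> A"
proof
  assume "affine_pt z \<in> coaffine_pt ` A"
  then obtain w where "w \<in> A" "affine_pt z = coaffine_pt w" by blast
  then show "z \<noteq> 0 \<and> inverse z \<in> A"
    by (cases "w = 0") (auto simp: coaffine_pt_eq_affine_pt)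
qed (auto simp: coaffine_pt_eq_affine_pt intro!: image_eqI[of _ _ "inverse z"])

lemma affine_pt_in_affine_image_iff: "affine_pt z \<in> affine_pt ` A \<longleftrightarrow> z \<in> A"
  by auto

text \<open>A chart is the quotient map restricted to a complex line in the punctured plane, and its inverse
  divides one homogeneous coordinate by the other; both are continuous. So topological questions
  about the projective line can be answered in the complex plane.\<close>

lemma open_cp1_iff:
  "open U \<longleftrightarrow> open {z. affine_pt z \<in> U} \<and> open {w. coaffine_pt w \<in> U}"
proof
  assume "open U"
  then have o: "open {v. v \<noteq> 0 \<and> abs_cp1 v \<in> U}" by (simp add: open_cp1_def)
  have "open ((\<lambda>z. (z, 1)) -` {v. v \<noteq> 0 \<and> abs_cp1 v \<in> U})"
    by (intro open_vimage o continuous_intros)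
  moreover have "open ((\<lambda>w. (1, w)) -` {v. v \<noteq> 0 \<and> abs_cp1 v \<in> U})"
    by (intro open_vimage o continuous_intros)
  ultimately show "open {z. affine_pt z \<in> U} \<and> open {w. coaffine_pt w \<in> U}"
    by (simp add: vimage_def hpoint_def zero_prod_def)
next
  assume o: "open {z. affine_pt z \<in> U} \<and> open {w. coaffine_pt w \<in> U}"
  have s: "open {v::complex \<times> complex. snd v \<noteq> 0}" "open {v::complex \<times> complex. fst v \<noteq> 0}"
    by (intro open_Collect_neq continuous_intros)+
  have "open ({v. snd v \<noteq> 0} \<inter> (\<lambda>v. fst v / snd v) -` {z. affine_pt z \<in> U})"
    using o s by (intro continuous_open_preimage continuous_intros) auto
  moreover have "open ({v. fst v \<noteq> 0} \<inter> (\<lambda>v. snd v / fst v) -` {w. coaffine_pt w \<in> U})"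
    using o s by (intro continuous_open_preimage continuous_intros) auto
  moreover have "{v. v \<noteq> 0 \<and> abs_cp1 v \<in> U} =
      ({v. snd v \<noteq> 0} \<inter> (\<lambda>v. fst v / snd v) -` {z. affine_pt z \<in> U}) \<union>
      ({v. fst v \<noteq> 0} \<inter> (\<lambda>v. snd v / fst v) -` {w. coaffine_pt w \<in> U})"
  proof (rule set_eqI)
    fix v :: "complex \<times> complex"
    obtain a b where "v = (a, b)" by (cases v)
    then show "v \<in> {v. v \<noteq> 0 \<and> abs_cp1 v \<in> U} \<longleftrightarrow>
      v \<in> ({v. snd v \<noteq> 0} \<inter> (\<lambda>v. fst v / snd v) -` {z. affine_pt z \<in> U}) \<union>
        ({v. fst v \<noteq> 0} \<inter> (\<lambda>v. snd v / fst v) -` {w. coaffine_pt w \<in> U})"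
      using abs_cp1_affine[of b a] abs_cp1_coaffine[of a b]
      by (cases "a = 0"; cases "b = 0") (auto simp: zero_prod_def)
  qed
  ultimately show "open U" unfolding open_cp1_def by auto
qed

lemma closed_cp1_iff:
  "closed C \<longleftrightarrow> closed {z. affine_pt z \<in> C} \<and> closed {w. coaffine_pt w \<in> C}"
  unfolding closed_def open_cp1_iff by (simp add: Collect_neg_eq)

lemma continuous_on_affine_pt: "continuous_on A affine_pt"
  by (rule continuous_on_subset[of UNIV])
    (auto simp: continuous_on_open_vimage vimage_def open_cp1_iff)

lemma continuous_on_coaffine_pt: "continuous_on A coaffine_pt"
  by (rule continuous_on_subset[of UNIV])
    (auto simp: continuous_on_open_vimage vimage_def open_cp1_iff)

lemma affine_pt_closure_subset: "affine_pt ` closure A \<subseteq> closure (affine_pt ` A)"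
  by (rule continuous_image_closure_subset[OF continuous_on_affine_pt[of UNIV]]) auto

lemma coaffine_pt_closure_subset: "coaffine_pt ` closure A \<subseteq> closure (coaffine_pt ` A)"
  by (rule continuous_image_closure_subset[OF continuous_on_coaffine_pt[of UNIV]]) auto

lemma connected_cp1: "Topological_Spaces.connected (UNIV :: cp1 set)"
proof -
  have "Topological_Spaces.connected (range affine_pt)"
    "Topological_Spaces.connected (range coaffine_pt)"
    by (auto intro!: connected_continuous_image continuous_on_affine_pt continuous_on_coaffine_pt)
  moreover have "affine_pt 1 \<in> range affine_pt \<inter> range coaffine_pt" by auto
  ultimately have "Topological_Spaces.connected (range affine_pt \<union> range coaffine_pt)"
    by (intro connected_Un) auto
  moreover have "range affine_pt \<union> range coaffine_pt = UNIV"
    by (auto intro: cp1_cases)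
  ultimately show ?thesis by simp
qed

text \<open>In the chart at infinity the image of \<open>K\<close> consists of the inverses of its nonzero points. As
  \<open>K\<close> is bounded, these stay away from the origin, around which inversion is not continuous.\<close>

lemma closed_affine_image:
  assumes "compact K"
  shows "closed (affine_pt ` K)"
proof -
  obtain r where r: "r > 0" "K \<subseteq> cball 0 r"
    using bounded_subset_ballD[OF compact_imp_bounded[OF assms], of 0] ball_subset_cball by blast
  have "{w. coaffine_pt w \<in> affine_pt ` K} = (- ball 0 (1 / r)) \<inter> inverse -` K"
  proof -
    have "1 / r \<le> norm w" if "w \<noteq> 0" "inverse w \<in> K" for w
    proof -
      have "inverse (norm w) \<le> r" using that r by (auto simp: norm_inverse dest!: subsetD)
      then show ?thesis using that r by (simp add: field_simps)
    qed
    moreover have "w \<noteq> 0" if "1 / r \<le> norm w" for w :: complex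
      using that r by auto
    moreover have "w \<in> - ball 0 (1 / r) \<longleftrightarrow> 1 / r \<le> norm w" for w :: complex
      by auto
    ultimately show ?thesis
      by (auto simp only: coaffine_pt_in_affine_image_iff Int_iff vimage_eq mem_Collect_eq)
  qed
  moreover have "closed ((- ball 0 (1 / r)) \<inter> inverse -` K :: complex set)"
    using r compact_imp_closed[OF assms]
    by (intro continuous_closed_preimage continuous_intros) auto
  ultimately show ?thesis
    unfolding closed_cp1_iff using compact_imp_closed[OF assms]
    by (simp add: affine_pt_in_affine_image_iff)
qed

section \<open>Closures of the model strata\<close>

lemma dense_nonreal: "closure {z. Im z \<noteq> 0} = UNIV"
proof -
  have "interior {z. \<i> \<bullet> z = 0} = {}"
    by (rule interior_hyperplane) auto
  moreover have "{z. Im z \<noteq> 0} = - {z. \<i> \<bullet> z = 0}" by (auto simp: inner_complex_def)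
  ultimately show ?thesis by (simp only: closure_complement) auto
qed

text \<open>Every set removed from the disc below lies on the unit circle or on the real line, so the
  nonreal points of the open disc survive, and they are already dense in the closed disc.\<close>

lemma closure_affine_disc_minus:
  assumes "B \<subseteq> sphere 0 1 \<union> {z. Im z = 0}"
  shows "closure (affine_pt ` (cball 0 1 - B)) = affine_pt ` cball 0 1"
proof
  show "closure (affine_pt ` (cball 0 1 - B)) \<subseteq> affine_pt ` cball 0 1"
    by (rule closure_minimal) (auto intro: closed_affine_image)
  have "closure (ball 0 1 \<inter> {z. Im z \<noteq> 0}) = closure (ball (0::complex) 1)"
    by (rule closure_open_Int_superset) (simp_all add: dense_nonreal)
  also have "\<dots> = cball 0 1" by simp
  finally have "cball 0 1 \<subseteq> closure (cball 0 1 - B)"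
    using closure_mono[of "ball 0 1 \<inter> {z. Im z \<noteq> 0}" "cball 0 1 - B"] assms by fastforce
  then show "affine_pt ` cball 0 1 \<subseteq> closure (affine_pt ` (cball 0 1 - B))"
    using affine_pt_closure_subset by blast
qed

text \<open>Inversion exchanges the inside and the outside of the unit circle, so the exterior of the disc
  is again a disc in the chart at infinity; this gives its closure at once.\<close>

lemma Compl_affine_disc:
  "- affine_pt ` cball 0 1 = coaffine_pt ` ball 0 1"
  "- affine_pt ` ball 0 1 = coaffine_pt ` cball 0 1"
proof -
  have *: "p \<in> coaffine_pt ` A \<longleftrightarrow> p \<notin> affine_pt ` B"
    if "0 \<in> A" "0 \<in> B" "\<And>z. z \<noteq> 0 \<Longrightarrow> inverse z \<in> A \<longleftrightarrow> z \<notin> B" for p A B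
  proof (cases p rule: cp1_cases)
    case (affine z)
    then show ?thesis using that(1,2) that(3)[of z]
      by (auto simp: affine_pt_in_coaffine_image_iff)
  next
    case infinity
    then show ?thesis using that(1) by auto
  qed
  have "inverse z \<in> ball 0 1 \<longleftrightarrow> z \<notin> cball 0 1" "inverse z \<in> cball 0 1 \<longleftrightarrow> z \<notin> ball 0 1"
    if "z \<noteq> 0" for z :: complex
    using that
    by (auto simp: norm_inverse inverse_less_1_iff inverse_le_1_iff simp del: zero_less_norm_iff)
  then have "p \<in> coaffine_pt ` ball 0 1 \<longleftrightarrow> p \<notin> affine_pt ` cball 0 1"
    "p \<in> coaffine_pt ` cball 0 1 \<longleftrightarrow> p \<notin> affine_pt ` ball 0 1" for p
    by (intro *; simp)+
  then show "- affine_pt ` cball 0 1 = coaffine_pt ` ball 0 1"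
    "- affine_pt ` ball 0 1 = coaffine_pt ` cball 0 1"
    by blast+
qed

lemma closure_Compl_affine_disc: "closure (- affine_pt ` cball 0 1) = - affine_pt ` ball 0 1"
proof
  have "{w. coaffine_pt w \<in> - affine_pt ` ball 0 1} = cball 0 1"
    unfolding Compl_affine_disc by auto
  moreover have "{z. affine_pt z \<in> - affine_pt ` ball 0 1} = - ball 0 1"
    by auto
  ultimately have "closed (- affine_pt ` ball 0 1)"
    unfolding closed_cp1_iff by (simp only: closed_cball closed_Compl open_ball)
  then show "closure (- affine_pt ` cball 0 1) \<subseteq> - affine_pt ` ball 0 1"
    by (intro closure_minimal) auto
  show "- affine_pt ` ball 0 1 \<subseteq> closure (- affine_pt ` cball 0 1)"
    using coaffine_pt_closure_subset[of "ball 0 1"] by (simp add: Compl_affine_disc)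
qed

text \<open>Density at infinity is immediate because the point at infinity itself is never removed.\<close>

lemma closure_Compl_affine_real:
  assumes "B \<subseteq> {z. Im z = 0}"
  shows "closure (- affine_pt ` B) = UNIV"
proof -
  have "p \<in> closure (- affine_pt ` B)" for p
  proof (cases p rule: cp1_cases)
    case (affine z)
    have "affine_pt ` closure {z. Im z \<noteq> 0} \<subseteq> closure (affine_pt ` {z. Im z \<noteq> 0})"
      by (rule affine_pt_closure_subset)
    also have "\<dots> \<subseteq> closure (- affine_pt ` B)"
      using assms by (intro closure_mono) auto
    finally show ?thesis using affine by (auto simp: dense_nonreal)
  next
    case infinity
    then show ?thesis using closure_subset by fastforce
  qed
  then show ?thesis by blast
qed


section \<open>Semialgebraicity of the model sets\<close>

lemma semialgebraic_ge:
  assumes "real_polynomial_function p"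
  shows "semialgebraic {x. p x \<ge> 0}"
proof -
  have "semialgebraic (- {x. - p x > 0})"
    using assms by (intro semialgebraic.intros real_polynomial_function_minus)
  moreover have "- {x. - p x > 0} = {x. p x \<ge> 0}" by auto
  ultimately show ?thesis by simp
qed

lemma semialgebraic_eq:
  assumes "real_polynomial_function p"
  shows "semialgebraic {x. p x = 0}"
proof -
  have "semialgebraic ({x. p x \<ge> 0} \<inter> {x. - p x \<ge> 0})"
    using assms by (intro semialgebraic_Int semialgebraic_ge real_polynomial_function_minus)
  moreover have "{x. p x \<ge> 0} \<inter> {x. - p x \<ge> 0} = {x. p x = 0}" by auto
  ultimately show ?thesis by simp
qed

lemma semialgebraic_UNIV: "semialgebraic UNIV"
  using semialgebraic_pos[of "\<lambda>x. 1"] by (simp add: real_polynomial_function.intros(2))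

lemma semialgebraic_empty: "semialgebraic {}"
  using semialgebraic_Compl[OF semialgebraic_UNIV] by simp

lemma semialgebraic_cp1_Compl: "semialgebraic_cp1 X \<Longrightarrow> semialgebraic_cp1 (- X)"
  unfolding semialgebraic_cp1_def by (auto simp: Collect_neg_eq intro: semialgebraic_Compl)

lemma semialgebraic_cp1_Int:
  "semialgebraic_cp1 X \<Longrightarrow> semialgebraic_cp1 Y \<Longrightarrow> semialgebraic_cp1 (X \<inter> Y)"
  unfolding semialgebraic_cp1_def by (auto simp: Collect_conj_eq intro: semialgebraic_Int)

lemma semialgebraic_cp1_Diff:
  "semialgebraic_cp1 X \<Longrightarrow> semialgebraic_cp1 Y \<Longrightarrow> semialgebraic_cp1 (X - Y)"
  unfolding Diff_eq by (intro semialgebraic_cp1_Int semialgebraic_cp1_Compl)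

lemma semialgebraic_cp1_empty: "semialgebraic_cp1 {}"
  by (simp add: semialgebraic_cp1_def semialgebraic_empty)

text \<open>In the chart at infinity an affine set turns into the set of its inverses, so both have to be
  described by polynomial conditions.\<close>

lemma semialgebraic_cp1_affine_image:
  assumes "semialgebraic A" "semialgebraic {w. w \<noteq> 0 \<and> inverse w \<in> A}"
  shows "semialgebraic_cp1 (affine_pt ` A)"
  using assms
  by (simp add: semialgebraic_cp1_def affine_pt_in_affine_image_iff coaffine_pt_in_affine_image_iff)

lemma real_polynomial_function_Re_Im:
  "real_polynomial_function Re" "real_polynomial_function Im"
  by (auto intro!: real_polynomial_function.intros(1) bounded_linear_Re bounded_linear_Im)

lemmas real_polynomial_intros =
  real_polynomial_function_Re_Im real_polynomial_function.intros(2) real_polynomial_function.intros(3)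
  real_polynomial_function_diff real_polynomial_function_power

lemma norm_le_1_iff: "norm z \<le> 1 \<longleftrightarrow> 1 - ((Re z)\<^sup>2 + (Im z)\<^sup>2) \<ge> 0" for z :: complex
  by (simp add: norm_complex_def)

lemma norm_eq_1_iff: "norm z = 1 \<longleftrightarrow> (Re z)\<^sup>2 + (Im z)\<^sup>2 - 1 = 0" for z :: complex
  by (simp add: norm_complex_def)

lemma semialgebraic_cp1_disc: "semialgebraic_cp1 (affine_pt ` cball 0 1)"
proof (rule semialgebraic_cp1_affine_image)
  have "cball 0 1 = {z. 1 - ((Re z)\<^sup>2 + (Im z)\<^sup>2) \<ge> 0}"
    by (auto simp: norm_le_1_iff simp del: diff_ge_0_iff_ge)
  then show "semialgebraic (cball 0 1 :: complex set)"
    by (auto intro!: semialgebraic_ge real_polynomial_intros simp del: diff_ge_0_iff_ge)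
  have "{w. w \<noteq> 0 \<and> inverse w \<in> cball 0 1} = {w. (Re w)\<^sup>2 + (Im w)\<^sup>2 - 1 \<ge> 0}"
  proof -
    have "w \<noteq> 0 \<and> inverse w \<in> cball 0 1 \<longleftrightarrow> 1 \<le> norm w" for w :: complex
      by (cases "w = 0") (auto simp: norm_inverse inverse_le_1_iff not_le)
    then show ?thesis by (simp add: norm_complex_def)
  qed
  then show "semialgebraic {w::complex. w \<noteq> 0 \<and> inverse w \<in> cball 0 1}"
    by (auto intro!: semialgebraic_ge real_polynomial_intros simp del: diff_ge_0_iff_ge)
qed

lemma semialgebraic_cp1_circle: "semialgebraic_cp1 (affine_pt ` sphere 0 1)"
proof (rule semialgebraic_cp1_affine_image)
  have sph: "sphere 0 1 = {z. (Re z)\<^sup>2 + (Im z)\<^sup>2 - 1 = 0}"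
    by (auto simp: norm_eq_1_iff)
  have "semialgebraic {z. (Re z)\<^sup>2 + (Im z)\<^sup>2 - 1 = 0}"
    by (intro semialgebraic_eq real_polynomial_intros)
  then show s: "semialgebraic (sphere 0 1 :: complex set)" unfolding sph .
  have "{w::complex. w \<noteq> 0 \<and> inverse w \<in> sphere 0 1} = sphere 0 1"
    by (auto simp: norm_inverse)
  then show "semialgebraic {w::complex. w \<noteq> 0 \<and> inverse w \<in> sphere 0 1}"
    using s by simp
qed

lemma semialgebraic_singleton: "semialgebraic {c :: complex}"
proof -
  have "semialgebraic {z. (Re z - Re c)\<^sup>2 + (Im z - Im c)\<^sup>2 = 0}"
    by (intro semialgebraic_eq real_polynomial_intros)
  moreover have "{z. (Re z - Re c)\<^sup>2 + (Im z - Im c)\<^sup>2 = 0} = {c}"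
    by (auto simp: complex_eq_iff sum_power2_eq_zero_iff)
  ultimately show ?thesis by simp
qed

lemma semialgebraic_cp1_singleton: "semialgebraic_cp1 (affine_pt ` {c})"
proof (rule semialgebraic_cp1_affine_image[OF semialgebraic_singleton])
  have "{w. w \<noteq> 0 \<and> inverse w \<in> {c}} = (if c = 0 then {} else {inverse c})"
    by (auto simp: inverse_eq_imp_eq)
  then show "semialgebraic {w. w \<noteq> 0 \<and> inverse w \<in> {c}}"
    by (simp add: semialgebraic_singleton semialgebraic_empty)
qed

text \<open>The open end at \<open>0\<close> is what matters: \<open>0\<close> is a limit point outside the slit. The bound \<open>1 / 2\<close>
  keeps the slit away from the unit circle.\<close>

definition slit :: "complex set" where
  "slit = {z. Im z = 0 \<and> 0 < Re z \<and> Re z < 1 / 2}"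

lemma semialgebraic_cp1_slit: "semialgebraic_cp1 (affine_pt ` slit)"
proof (rule semialgebraic_cp1_affine_image)
  have "semialgebraic ({z. Im z = 0} \<inter> ({z. Re z > 0} \<inter> {z. 1 / 2 - Re z > 0}))"
    by (intro semialgebraic_Int semialgebraic_eq semialgebraic_pos real_polynomial_intros)
  moreover have "{z. Im z = 0} \<inter> ({z. Re z > 0} \<inter> {z. 1 / 2 - Re z > 0}) = slit"
    by (auto simp: slit_def)
  ultimately show "semialgebraic slit" by simp
  have "semialgebraic ({z. Im z = 0} \<inter> {z. Re z - 2 > 0})"
    by (intro semialgebraic_Int semialgebraic_eq semialgebraic_pos real_polynomial_intros)
  moreover have "w \<noteq> 0 \<and> inverse w \<in> slit \<longleftrightarrow> Im w = 0 \<and> Re w - 2 > 0" for w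
  proof (cases "Im w = 0")
    case True
    then have w: "w = complex_of_real (Re w)" by (simp add: complex_eq_iff)
    have inv: "inverse w = complex_of_real (inverse (Re w))"
      by (subst w) (simp only: of_real_inverse)
    have "w \<noteq> 0 \<and> inverse w \<in> slit \<longleftrightarrow> 0 < inverse (Re w) \<and> inverse (Re w) < 1 / 2"
      unfolding inv using True by (auto simp: slit_def complex_eq_iff simp del: of_real_inverse)
    also have "\<dots> \<longleftrightarrow> Re w > 2"
      by (cases "Re w > 0") (auto simp: field_simps)
    finally show ?thesis using True by simp
  qed (auto simp: slit_def complex_eq_iff)
  then have "{w. w \<noteq> 0 \<and> inverse w \<in> slit} = {z. Im z = 0} \<inter> {z. Re z - 2 > 0}" by auto
  ultimately show "semialgebraic {w. w \<noteq> 0 \<and> inverse w \<in> slit}" by simp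
qed

lemma zero_in_closure_slit: "0 \<in> closure slit"
proof -
  have "\<exists>y\<in>slit. dist y 0 < e" if "e > 0" for e
    using that by (intro bexI[of _ "complex_of_real (min (e / 2) (1 / 4))"])
      (auto simp: slit_def min_def)
  then show ?thesis by (simp add: closure_approachable)
qed

section \<open>Adjacency of strata\<close>

definition touches :: "stability_data \<Rightarrow> mark \<Rightarrow> mark \<Rightarrow> bool" where
  "touches S i j \<longleftrightarrow> closure (stratum S i) \<inter> stratum S j \<noteq> {}"

lemma touches_imp_nonempty:
  assumes "touches S i j"
  shows "stratum S i \<noteq> {}" "stratum S j \<noteq> {}"
  using assms by (auto simp: touches_def)

lemma touches_refl: "stratum S i \<noteq> {} \<Longrightarrow> touches S i i"
  using closure_subset[of "stratum S i"] by (auto simp: touches_def)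

text \<open>The unstable stratum is the complement of a closed set that contains the other two strata.\<close>

lemma touches_Unstab:
  assumes "touches S i Unstab"
  shows "i = Unstab"
proof (rule ccontr)
  assume "i \<noteq> Unstab"
  then have "stratum S i \<subseteq> closure (stable_locus S)"
    using closure_subset by (cases i) auto
  then have "closure (stratum S i) \<subseteq> closure (stable_locus S)"
    by (simp add: closure_minimal)
  with assms show False by (auto simp: touches_def)
qed

lemma touches_Stab_Semistab:
  "stratum S Semistab \<noteq> {} \<Longrightarrow> touches S Stab Semistab"
  by (auto simp: touches_def)

lemma Semistab_imp_Stab_nonempty:
  "stratum S Semistab \<noteq> {} \<Longrightarrow> stratum S Stab \<noteq> {}"
  by auto

text \<open>Otherwise the closures of \<open>\<Omega>\<close> and of the unstable stratum would separate the connected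
  projective line.\<close>

lemma Unstab_touches_rest:
  assumes "ambient S = UNIV" "stratum S Unstab \<noteq> {}" "stratum S Stab \<noteq> {}"
  shows "touches S Unstab Stab \<or> touches S Unstab Semistab"
proof (rule ccontr)
  assume no: "\<not> ?thesis"
  let ?A = "closure (stable_locus S)" and ?B = "closure (stratum S Unstab)"
  have "?A \<inter> ?B = {}" using no by (auto simp: touches_def)
  moreover have "?A \<union> ?B = UNIV"
    using assms(1) closure_subset[of "stratum S Unstab"] by auto
  moreover have "?A \<noteq> {}" "?B \<noteq> {}" using assms by auto
  ultimately show False
    using connected_cp1 unfolding connected_closed
    by (metis Int_UNIV_right closed_closure subset_UNIV order_refl)
qed

lemma stratum_eqD:
  assumes "stratum S i = stratum S j" "stratum S i \<noteq> {}"
  shows "i = j"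
  using assms stratum_disjoint[of i j S] by (cases "i = j") auto

lemma pverts_adj: "pverts (adj S) = stratum S ` {i. stratum S i \<noteq> {}}"
  by (auto simp: adj_def)

lemma parcs_adj: "parcs (adj S) = {(stratum S i, stratum S j) | i j. touches S i j}"
proof -
  have "touches S i j \<longleftrightarrow> stratum S i \<noteq> {} \<and> stratum S j \<noteq> {} \<and>
      closure (stratum S i) \<inter> stratum S j \<noteq> {}" for i j
    using touches_imp_nonempty by (auto simp: touches_def)
  then show ?thesis by (simp add: adj_def)
qed

lemma arc_adj_iff:
  assumes "stratum S i \<noteq> {}" "stratum S j \<noteq> {}"
  shows "(stratum S i, stratum S j) \<in> parcs (adj S) \<longleftrightarrow> touches S i j"
proof
  assume "(stratum S i, stratum S j) \<in> parcs (adj S)"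
  then obtain k l where "stratum S i = stratum S k" "stratum S j = stratum S l" "touches S k l"
    by (auto simp: parcs_adj)
  then show "touches S i j" using assms stratum_eqD by metis
qed (auto simp: parcs_adj)

text \<open>Any two vertices are joined in the underlying graph by a path of two
  arcs through \<open>h\<close>. Every adjacency digraph has such a vertex.\<close>

lemma connected_if_hub:
  assumes "pair_wf_digraph G" "h \<in> pverts G"
    and "\<And>v. v \<in> pverts G \<Longrightarrow> (v, h) \<in> parcs G \<or> (h, v) \<in> parcs G"
  shows "Digraph_Component.connected (with_proj G)"
proof -
  interpret pair_wf_digraph G by fact
  interpret M: pair_wf_digraph "mk_symmetric (with_proj G)" by (rule wellformed_mk_symmetric)
  have "(v, h) \<in> parcs (mk_symmetric (with_proj G))" "(h, v) \<in> parcs (mk_symmetric (with_proj G))"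
    if "v \<in> pverts G" for v
    using assms(3)[OF that]
    by (auto simp: parcs_mk_symmetric intro: bexI[of _ "(v, h)"] bexI[of _ "(h, v)"])
  then have "u \<rightarrow>\<^sup>*\<^bsub>with_proj (mk_symmetric (with_proj G))\<^esub> v" if "u \<in> pverts G" "v \<in> pverts G" for u v
    using that by (meson M.reachable_adjI M.reachable_trans)
  then show ?thesis
    using assms(2) unfolding Digraph_Component.connected_def strongly_connected_def by auto
qed

text \<open>The one consequence of weak connectedness that restricts the shape of the digraph: without
  such an arc, every walk that starts at \<open>u\<close> would stay at \<open>u\<close>.\<close>

lemma connected_imp_incident_arc:
  assumes "Digraph_Component.connected (with_proj G)" "u \<in> pverts G" "v \<in> pverts G" "u \<noteq> v"
  obtains w where "w \<noteq> u" "(u, w) \<in> parcs G \<or> (w, u) \<in> parcs G"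
proof -
  have "(u, v) \<in> rtrancl_on (pverts G) (parcs (mk_symmetric (with_proj G)))"
    using assms by (auto simp: Digraph_Component.connected_def strongly_connected_def reachable_def)
  then have "v = u \<or> (\<exists>w. w \<noteq> u \<and> ((u, w) \<in> parcs G \<or> (w, u) \<in> parcs G))"
    by (induct rule: rtrancl_on_induct) (auto simp: parcs_mk_symmetric)
  with assms(4) that show thesis by blast
qed

lemma adj_satisfies_conditions:
  assumes "stability_theory S"
  shows "marked_digraph (adj S) (adj_mark S)" "adjacency_conditions (adj S) (adj_mark S)"
proof -
  have amb: "ambient S = UNIV" using assms by (simp add: stability_theory_def)
  have UM: "UNIV = {Stab, Semistab, Unstab}" by (auto intro: mark.exhaust)
  have fin: "finite (UNIV :: mark set)" unfolding UM by simp
  have verts_sub: "pverts (adj S) \<subseteq> range (stratum S)" by (auto simp: pverts_adj)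
  have finV: "finite (pverts (adj S))"
    using fin verts_sub by (meson finite_imageI finite_subset)
  have arcs_sub: "parcs (adj S) \<subseteq> pverts (adj S) \<times> pverts (adj S)"
    by (auto simp: pverts_adj parcs_adj dest: touches_imp_nonempty)
  have wf: "pair_wf_digraph (adj S)"
    using arcs_sub by unfold_locales auto
  have pf: "pair_fin_digraph (adj S)"
    using finV arcs_sub wf
    by (simp add: pair_fin_digraph_def pair_fin_digraph_axioms_def finite_subset[OF arcs_sub])
  have "card (pverts (adj S)) \<le> card (range (stratum S))"
    using fin verts_sub by (intro card_mono) auto
  also have "\<dots> \<le> card (UNIV :: mark set)" using fin by (rule card_image_le)
  also have "\<dots> = 3" unfolding UM by simp
  finally have card: "card (pverts (adj S)) \<le> 3" .
  have "(UNIV :: cp1 set) = (\<Union>i. stratum S i)"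
    using amb by (auto simp: UM)
  then have some: "\<exists>i. stratum S i \<noteq> {}" by blast
  then have ne: "pverts (adj S) \<noteq> {}" by (auto simp: pverts_adj)
  have "inj_on (adj_mark S) (pverts (adj S))"
    by (auto simp: inj_on_def pverts_adj adj_mark_stratum)
  with pf ne card show "marked_digraph (adj S) (adj_mark S)" by (simp add: marked_digraph_def)

  \<comment> \<open>The hub is the semistable stratum if the unstable one touches it. Otherwise it is the stable
    stratum; and without stable points the unstable stratum is the only one.\<close>
  have "\<exists>h. stratum S h \<noteq> {} \<and> (\<forall>i. stratum S i \<noteq> {} \<longrightarrow> touches S i h \<or> touches S h i)"
  proof -
    consider "touches S Unstab Semistab" | "\<not> touches S Unstab Semistab" "stratum S Stab \<noteq> {}"
      | "stratum S Stab = {}" by blast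
    then show ?thesis
    proof cases
      case 1
      then show ?thesis
        by (intro exI[of _ Semistab])
          (metis mark.exhaust touches_Stab_Semistab touches_imp_nonempty(2) touches_refl)
    next
      case 2
      then show ?thesis
        using Unstab_touches_rest[OF amb]
        by (intro exI[of _ Stab]) (metis mark.exhaust touches_Stab_Semistab touches_refl)
    next
      case 3
      then show ?thesis using some
        by (metis mark.exhaust Semistab_imp_Stab_nonempty touches_refl)
    qed
  qed
  then obtain h where "stratum S h \<noteq> {}"
      "\<And>i. stratum S i \<noteq> {} \<Longrightarrow> touches S i h \<or> touches S h i" by blast
  then have "stratum S h \<in> pverts (adj S)"
      "\<And>v. v \<in> pverts (adj S) \<Longrightarrow>
        (v, stratum S h) \<in> parcs (adj S) \<or> (stratum S h, v) \<in> parcs (adj S)"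
    unfolding pverts_adj parcs_adj by blast+
  then have "Digraph_Component.connected (with_proj (adj S))"
    by (rule connected_if_hub[OF wf])
  moreover have "\<forall>v\<in>pverts (adj S). (v, v) \<in> parcs (adj S)"
    using arc_adj_iff touches_refl unfolding pverts_adj by blast
  moreover have "u = v" if uv: "(u, v) \<in> parcs (adj S)" "adj_mark S v = Unstab" for u v
  proof -
    obtain i j where ij: "u = stratum S i" "v = stratum S j" "touches S i j"
      using uv(1) unfolding parcs_adj by blast
    then have "j = Unstab"
      using uv(2) adj_mark_stratum touches_imp_nonempty(2) by metis
    then show ?thesis using ij touches_Unstab by blast
  qed
  moreover have "(u, v) \<in> parcs (adj S)"
    if uv: "u \<in> pverts (adj S)" "v \<in> pverts (adj S)" "adj_mark S u = Stab" "adj_mark S v = Semistab"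
    for u v
  proof -
    have "u = stratum S Stab" "v = stratum S Semistab" "v \<noteq> {}"
      using uv adj_mark_stratum unfolding pverts_adj by fastforce+
    then show ?thesis
      using touches_Stab_Semistab unfolding parcs_adj by blast
  qed
  moreover have "adj_mark S ` pverts (adj S) = {i. stratum S i \<noteq> {}}"
    unfolding pverts_adj image_image using adj_mark_stratum[of S] by (auto simp del: stratum.simps)
  ultimately show "adjacency_conditions (adj S) (adj_mark S)"
    unfolding adjacency_conditions_def using Semistab_imp_Stab_nonempty[of S]
    by (simp only: mem_Collect_eq) blast
qed

section \<open>Realizing adjacency relations\<close>

abbreviation theory_of :: "cp1 set \<Rightarrow> stability_data" where
  "theory_of \<Omega> \<equiv> \<lparr>ambient = UNIV, stable_locus = \<Omega>, base_point = cp1_infinity\<rparr>"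

lemma stability_theory_of: "semialgebraic_cp1 \<Omega> \<Longrightarrow> stability_theory (theory_of \<Omega>)"
  by (simp add: stability_theory_def)

text \<open>The part of the semistable stratum inside the disc: \<open>ne\<close> says whether semistable points are
  wanted at all, and \<open>acc\<close> whether they should accumulate at a stable point, for which \<open>0\<close>
  serves.\<close>

lemma interior_defect_exists:
  assumes "acc \<longrightarrow> ne"
  obtains P where "P \<subseteq> ball 0 1" "P \<subseteq> {z. Im z = 0}" "semialgebraic_cp1 (affine_pt ` P)"
    "P \<noteq> {} \<longleftrightarrow> ne" "acc \<longrightarrow> 0 \<in> closure P - P" "\<not> acc \<longrightarrow> compact P"
proof -
  have sub: "slit \<subseteq> ball 0 1"
    by (auto simp: slit_def norm_complex_def)
  have ne: "slit \<noteq> {}" using zero_in_closure_slit by auto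
  consider acc | "\<not> acc" ne | "\<not> acc" "\<not> ne" by blast
  then show thesis
  proof cases
    case 1
    with assms sub ne show thesis
      using semialgebraic_cp1_slit zero_in_closure_slit by (intro that[of slit]) (auto simp: slit_def)
  next
    case 2
    then show thesis using semialgebraic_cp1_singleton[of 0] by (intro that[of "{0}"]) auto
  next
    case 3
    then show thesis using semialgebraic_cp1_empty by (intro that[of "{}"]) auto
  qed
qed

text \<open>The part of the semistable stratum on the unit circle: \<open>st\<close> and \<open>ss\<close> say whether the circle
  should contain stable and semistable points. Being nonempty, it contains at least one kind.\<close>

lemma boundary_defect_exists:
  assumes "st \<or> ss"
  obtains Q where "Q \<subseteq> sphere (0::complex) 1" "compact Q" "semialgebraic_cp1 (affine_pt ` Q)"
    "sphere 0 1 \<subseteq> Q \<longleftrightarrow> \<not> st" "Q \<noteq> {} \<longleftrightarrow> ss"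
proof -
  have in_sphere: "1 \<in> sphere (0::complex) 1" "-1 \<in> sphere (0::complex) 1" by auto
  consider "\<not> st" | st ss | st "\<not> ss" by blast
  then show thesis
  proof cases
    case 1
    with assms show thesis
      using semialgebraic_cp1_circle in_sphere by (intro that[of "sphere 0 1"]) auto
  next
    case 2
    have "\<not> sphere (0::complex) 1 \<subseteq> {1}"
    proof
      assume "sphere (0::complex) 1 \<subseteq> {1}"
      then have "- 1 \<in> {1 :: complex}" using in_sphere(2) by (rule subsetD)
      then show False by simp
    qed
    with 2 show thesis
      using semialgebraic_cp1_singleton[of 1] by (intro that[of "{1}"]) simp_all
  next
    case 3
    have "\<not> sphere (0::complex) 1 \<subseteq> {}" using in_sphere by blast
    with 3 show thesis using semialgebraic_cp1_empty by (intro that[of "{}"]) simp_all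
  qed
qed

lemma strata_disc_minus:
  assumes "B \<subseteq> cball 0 1" "B \<subseteq> sphere 0 1 \<union> {z. Im z = 0}"
  defines "S \<equiv> theory_of (affine_pt ` (cball 0 1 - B))"
  shows "stratum S Stab = affine_pt ` (cball 0 1 - B)"
    and "stratum S Semistab = affine_pt ` B"
    and "stratum S Unstab = - affine_pt ` cball 0 1"
    and "touches S Unstab Stab \<longleftrightarrow> \<not> sphere 0 1 \<subseteq> B"
    and "touches S Unstab Semistab \<longleftrightarrow> sphere 0 1 \<inter> B \<noteq> {}"
proof -
  show st: "stratum S Stab = affine_pt ` (cball 0 1 - B)" by (simp add: S_def)
  show ss: "stratum S Semistab = affine_pt ` B"
    using assms(1) by (auto simp: S_def closure_affine_disc_minus[OF assms(2)])
  show un: "stratum S Unstab = - affine_pt ` cball 0 1"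
    by (auto simp: S_def closure_affine_disc_minus[OF assms(2)])
  have meets: "(- affine_pt ` ball 0 1) \<inter> affine_pt ` A \<noteq> {} \<longleftrightarrow> sphere 0 1 \<inter> A \<noteq> {}"
    if "A \<subseteq> cball 0 1" for A
  proof -
    have "(- affine_pt ` ball 0 1) \<inter> affine_pt ` A = affine_pt ` (A - ball 0 1)" by auto
    moreover have "A - ball 0 1 = sphere 0 1 \<inter> A" using that by force
    ultimately show ?thesis by simp
  qed
  show "touches S Unstab Stab \<longleftrightarrow> \<not> sphere 0 1 \<subseteq> B"
    unfolding touches_def un st closure_Compl_affine_disc by (subst meets) auto
  show "touches S Unstab Semistab \<longleftrightarrow> sphere 0 1 \<inter> B \<noteq> {}"
    unfolding touches_def un ss closure_Compl_affine_disc by (subst meets) (use assms in auto)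
qed

lemma strata_Compl_real:
  assumes "B \<subseteq> {z. Im z = 0}"
  defines "S \<equiv> theory_of (- affine_pt ` B)"
  shows "stratum S Stab = - affine_pt ` B"
    and "stratum S Semistab = affine_pt ` B"
    and "stratum S Unstab = {}"
  by (auto simp: S_def closure_Compl_affine_real[OF assms(1)])

text \<open>If \<open>acc\<close> holds, then \<open>P\<close> leads to the stable point \<open>0\<close>; otherwise the semistable stratum is
  closed, and being disjoint from the stable one it does not touch it.\<close>

lemma Semistab_touches_Stab_iff:
  assumes "stratum S Semistab = affine_pt ` B" "P \<subseteq> B"
    and "acc \<longrightarrow> 0 \<in> closure P" "acc \<longrightarrow> affine_pt 0 \<in> stratum S Stab"
    and "\<not> acc \<longrightarrow> compact B"
  shows "touches S Semistab Stab \<longleftrightarrow> acc"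
proof (cases acc)
  case True
  have "affine_pt 0 \<in> affine_pt ` closure B"
    using True assms(2,3) closure_mono by blast
  then have "affine_pt 0 \<in> closure (stratum S Semistab)"
    using affine_pt_closure_subset assms(1) by auto
  then show ?thesis using True assms(4) by (auto simp: touches_def)
next
  case False
  then have "closure (stratum S Semistab) = stratum S Semistab"
    using assms closed_affine_image closure_closed by metis
  then show ?thesis
    using False stratum_disjoint[of Semistab Stab S] by (simp only: touches_def) simp
qed

text \<open>Among the nine possible arcs, the conditions fix the three loops, the two arcs into the
  unstable vertex and the arc \<open>(s, ss)\<close>. Agreement on the other three is therefore enough.\<close>

lemma touches_determined:
  assumes arcs: "E \<subseteq> M \<times> M" and loops: "\<And>i. i \<in> M \<Longrightarrow> (i, i) \<in> E"
    and un: "\<And>i. (i, Unstab) \<in> E \<Longrightarrow> i = Unstab"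
    and s_ss: "Stab \<in> M \<Longrightarrow> Semistab \<in> M \<Longrightarrow> (Stab, Semistab) \<in> E"
    and M: "\<And>i. stratum S i \<noteq> {} \<longleftrightarrow> i \<in> M"
    and "touches S Semistab Stab \<longleftrightarrow> (Semistab, Stab) \<in> E"
    and "touches S Unstab Stab \<longleftrightarrow> (Unstab, Stab) \<in> E"
    and "touches S Unstab Semistab \<longleftrightarrow> (Unstab, Semistab) \<in> E"
  shows "touches S i j \<longleftrightarrow> (i, j) \<in> E"
proof -
  have "touches S i i \<longleftrightarrow> (i, i) \<in> E" for i
    using arcs loops M touches_refl touches_imp_nonempty by (metis mem_Sigma_iff subsetD)
  moreover have "touches S i Unstab \<longleftrightarrow> (i, Unstab) \<in> E" if "i \<noteq> Unstab" for i
    using that un touches_Unstab by blast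
  moreover have "touches S Stab Semistab \<longleftrightarrow> (Stab, Semistab) \<in> E"
    using arcs s_ss M touches_Stab_Semistab touches_imp_nonempty by (metis mem_Sigma_iff subsetD)
  ultimately show ?thesis using assms(6-8) by (cases i; cases j) auto
qed

text \<open>The combinatorial form of the existence statement: \<open>M\<close> is a set of marks and \<open>E\<close> an adjacency
  relation on it, and weak connectedness enters through \<open>conn\<close>.\<close>

lemma realize_adjacency:
  assumes arcs: "E \<subseteq> M \<times> M" and ne: "M \<noteq> {}" and loops: "\<And>i. i \<in> M \<Longrightarrow> (i, i) \<in> E"
    and un: "\<And>i. (i, Unstab) \<in> E \<Longrightarrow> i = Unstab"
    and s_ss: "Stab \<in> M \<Longrightarrow> Semistab \<in> M \<Longrightarrow> (Stab, Semistab) \<in> E"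
    and ss_s: "Semistab \<in> M \<Longrightarrow> Stab \<in> M"
    and conn: "Unstab \<in> M \<Longrightarrow> Stab \<in> M \<Longrightarrow> (Unstab, Stab) \<in> E \<or> (Unstab, Semistab) \<in> E"
  obtains S where "stability_theory S" "\<And>i. stratum S i \<noteq> {} \<longleftrightarrow> i \<in> M"
    "\<And>i j. touches S i j \<longleftrightarrow> (i, j) \<in> E"
proof -
  have mem: "i \<in> M" "j \<in> M" if "(i, j) \<in> E" for i j using that arcs by auto
  obtain P where P: "P \<subseteq> ball 0 1" "P \<subseteq> {z. Im z = 0}" "semialgebraic_cp1 (affine_pt ` P)"
      "P \<noteq> {} \<longleftrightarrow> Semistab \<in> M"
      "(Semistab, Stab) \<in> E \<longrightarrow> 0 \<in> closure P - P" "(Semistab, Stab) \<notin> E \<longrightarrow> compact P"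
    using interior_defect_exists[of "(Semistab, Stab) \<in> E" "Semistab \<in> M"] mem by auto
  have "\<exists>S. stability_theory S \<and> (\<forall>i. stratum S i \<noteq> {} \<longleftrightarrow> i \<in> M) \<and>
      (touches S Semistab Stab \<longleftrightarrow> (Semistab, Stab) \<in> E) \<and>
      (touches S Unstab Stab \<longleftrightarrow> (Unstab, Stab) \<in> E) \<and>
      (touches S Unstab Semistab \<longleftrightarrow> (Unstab, Semistab) \<in> E)"
  proof -
    consider (no_un) "Unstab \<notin> M" | (only_un) "Unstab \<in> M" "Stab \<notin> M"
      | (un_s) "Unstab \<in> M" "Stab \<in> M" by blast
    then show ?thesis
    proof cases
      case no_un
      then have s: "Stab \<in> M" using ne ss_s by (metis ex_in_conv mark.exhaust)
      let ?S = "theory_of (- affine_pt ` P)"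
      note strata = strata_Compl_real[OF P(2)]
      have "touches ?S Semistab Stab \<longleftrightarrow> (Semistab, Stab) \<in> E"
        by (rule Semistab_touches_Stab_iff[OF strata(2) subset_refl]) (use P in auto)
      moreover have "\<not> touches ?S Unstab i" for i
        using touches_imp_nonempty strata(3) by blast
      moreover have "stratum ?S i \<noteq> {} \<longleftrightarrow> i \<in> M" for i
      proof (cases i)
        case Stab
        have "coaffine_pt 0 \<in> - affine_pt ` P" by auto
        then show ?thesis unfolding Stab strata(1) using s by blast
      next
        case Semistab
        then show ?thesis using P(4) strata(2) by simp
      next
        case Unstab
        then show ?thesis using no_un strata(3) by simp
      qed
      moreover have "stability_theory ?S"
        using P(3) by (intro stability_theory_of semialgebraic_cp1_Compl)
      ultimately show ?thesis using no_un mem(1)[of Unstab] by blast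
    next
      case only_un
      let ?S = "theory_of {}"
      have strata: "stratum ?S i \<noteq> {} \<longleftrightarrow> i = Unstab" for i by (cases i) auto
      have M: "i \<in> M \<longleftrightarrow> i = Unstab" for i using only_un ss_s by (cases i) auto
      have "stability_theory ?S" by (intro stability_theory_of semialgebraic_cp1_empty)
      moreover have "\<not> touches ?S i Stab" "\<not> touches ?S i Semistab" for i
        using touches_imp_nonempty(2)[of ?S] strata by (metis mark.distinct)+
      moreover have "(i, Stab) \<notin> E" "(i, Semistab) \<notin> E" for i
        using mem(2) M by (metis mark.distinct)+
      ultimately show ?thesis using strata M by metis
    next
      case un_s
      obtain Q where Q: "Q \<subseteq> sphere 0 1" "compact Q" "semialgebraic_cp1 (affine_pt ` Q)"
          "sphere 0 1 \<subseteq> Q \<longleftrightarrow> (Unstab, Stab) \<notin> E" "Q \<noteq> {} \<longleftrightarrow> (Unstab, Semistab) \<in> E"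
        using boundary_defect_exists[OF conn[OF un_s]] by metis
      let ?B = "P \<union> Q"
      let ?S = "theory_of (affine_pt ` (cball 0 1 - ?B))"
      have disj: "P \<inter> sphere 0 1 = {}" using P(1) by auto
      have B: "?B \<subseteq> cball 0 1" "?B \<subseteq> sphere 0 1 \<union> {z. Im z = 0}"
        using P(1,2) Q(1) by (auto simp: subset_iff less_imp_le)
      note strata = strata_disc_minus[OF B]
      have "touches ?S Unstab Stab \<longleftrightarrow> (Unstab, Stab) \<in> E"
        using strata(4) Q(4) disj by blast
      moreover have "touches ?S Unstab Semistab \<longleftrightarrow> (Unstab, Semistab) \<in> E"
        using strata(5) Q(1,5) disj by blast
      moreover have "touches ?S Semistab Stab \<longleftrightarrow> (Semistab, Stab) \<in> E"
      proof (rule Semistab_touches_Stab_iff[OF strata(2)])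
        show "P \<subseteq> ?B" by blast
        show "(Semistab, Stab) \<in> E \<longrightarrow> 0 \<in> closure P" using P(5) by blast
        have "0 \<in> cball (0::complex) 1" "0 \<notin> sphere (0::complex) 1" by simp_all
        then show "(Semistab, Stab) \<in> E \<longrightarrow> affine_pt 0 \<in> stratum ?S Stab"
          unfolding strata(1) using P(5) Q(1) by blast
        show "(Semistab, Stab) \<notin> E \<longrightarrow> compact ?B" using P(6) Q(2) compact_Un by blast
      qed
      moreover have "stratum ?S i \<noteq> {} \<longleftrightarrow> i \<in> M" for i
      proof (cases i)
        case Stab
        \<comment> \<open>\<open>\<i> / 2\<close> is a point of the disc that no choice of \<open>P\<close> and \<open>Q\<close> removes.\<close>
        have "\<i> / 2 \<notin> {z. Im z = 0}" "\<i> / 2 \<notin> sphere 0 1" "\<i> / 2 \<in> cball 0 1"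
          by (simp_all add: norm_divide)
        then have "\<i> / 2 \<in> cball 0 1 - ?B" using P(2) Q(1) by blast
        then show ?thesis unfolding Stab strata(1) using un_s by blast
      next
        case Semistab
        have "?B \<noteq> {} \<longleftrightarrow> Semistab \<in> M" using P(4) Q(5) mem(2) by blast
        then show ?thesis unfolding Semistab strata(2) by simp
      next
        case Unstab
        have "coaffine_pt 0 \<in> - affine_pt ` cball 0 1" by auto
        then show ?thesis unfolding Unstab strata(3) using un_s by blast
      qed
      moreover have "stability_theory ?S"
      proof (rule stability_theory_of)
        have "affine_pt ` (cball 0 1 - ?B) = affine_pt ` cball 0 1 - affine_pt ` P - affine_pt ` Q"
          by auto
        then show "semialgebraic_cp1 (affine_pt ` (cball 0 1 - ?B))"
          using semialgebraic_cp1_Diff[OF semialgebraic_cp1_Diff[OF semialgebraic_cp1_disc P(3)] Q(3)]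
          by (simp only:)
      qed
      ultimately show ?thesis by blast
    qed
  qed
  then obtain S where S: "stability_theory S" "\<And>i. stratum S i \<noteq> {} \<longleftrightarrow> i \<in> M"
      "touches S Semistab Stab \<longleftrightarrow> (Semistab, Stab) \<in> E"
      "touches S Unstab Stab \<longleftrightarrow> (Unstab, Stab) \<in> E"
      "touches S Unstab Semistab \<longleftrightarrow> (Unstab, Semistab) \<in> E"
    by blast
  then show thesis
    using touches_determined[OF arcs loops un s_ss S(2-5)] by (intro that[of S])
qed

text \<open>Marks are injective on both sides, so sending a vertex to the stratum with the same mark is the
  only candidate for an isomorphism.\<close>

lemma marked_digraph_iso_adjI:
  assumes "pair_wf_digraph G" and inj: "inj_on \<mu> (pverts G)"
    and strata: "\<And>i. stratum S i \<noteq> {} \<longleftrightarrow> i \<in> \<mu> ` pverts G"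
    and arcs: "\<And>i j. touches S i j \<longleftrightarrow> (i, j) \<in> map_prod \<mu> \<mu> ` parcs G"
  shows "marked_digraph_iso G \<mu> (adj S) (adj_mark S)"
proof -
  interpret pair_wf_digraph G by fact
  define g where "g = (\<lambda>v. stratum S (\<mu> v))"
  define f where "f = \<lparr>iso_verts = g, iso_arcs = map_prod g g, iso_head = snd, iso_tail = fst\<rparr>"
  have ne: "stratum S (\<mu> v) \<noteq> {}" if "v \<in> pverts G" for v using strata that by blast
  have g: "inj_on g (pverts G)"
    unfolding g_def using ne inj by (auto simp: inj_on_def dest!: stratum_eqD)
  have sub: "parcs G \<subseteq> pverts G \<times> pverts G"
    using arc_fst_in_verts arc_snd_in_verts by fastforce
  have "inj_on (map_prod g g) (parcs G)"
    using map_prod_inj_on[OF g g] sub by (rule inj_on_subset)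
  then have "pre_digraph.digraph_isomorphism (with_proj G) f"
    unfolding digraph_isomorphism_def using g wf_digraph by (simp add: f_def)
  moreover have "pverts (adj S) = g ` pverts G"
    unfolding pverts_adj g_def using strata by (auto simp del: stratum.simps)
  moreover have "parcs (adj S) = map_prod g g ` parcs G"
    unfolding parcs_adj g_def arcs by force
  then have "with_proj (adj S) = app_iso f (with_proj G)"
    using \<open>pverts (adj S) = g ` pverts G\<close> by (simp add: with_proj_def app_iso_def f_def)
  moreover have "\<forall>v\<in>pverts G. adj_mark S (iso_verts f v) = \<mu> v"
    using ne by (auto simp: f_def g_def adj_mark_stratum)
  ultimately show ?thesis unfolding marked_digraph_iso_def by blast
qed

text \<open>Weak connectedness provides an arc between the unstable vertex and another one; as arcs into
  the unstable vertex are excluded, it must point away from it.\<close>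

lemma conditions_imp_realizable:
  assumes "marked_digraph G \<mu>" "adjacency_conditions G \<mu>"
  shows "\<exists>S. stability_theory S \<and> marked_digraph_iso G \<mu> (adj S) (adj_mark S)"
proof -
  interpret pair_fin_digraph G using assms(1) by (simp add: marked_digraph_def)
  have ne: "pverts G \<noteq> {}" and inj: "inj_on \<mu> (pverts G)"
    using assms(1) by (auto simp: marked_digraph_def)
  have loops: "(v, v) \<in> parcs G" if "v \<in> pverts G" for v
    using assms(2) that by (auto simp: adjacency_conditions_def)
  have con: "Digraph_Component.connected (with_proj G)"
    using assms(2) by (auto simp: adjacency_conditions_def)
  have un: "u = v" if "(u, v) \<in> parcs G" "\<mu> v = Unstab" for u v
    using assms(2) that by (auto simp: adjacency_conditions_def)
  have s_ss: "(u, v) \<in> parcs G"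
    if "u \<in> pverts G" "v \<in> pverts G" "\<mu> u = Stab" "\<mu> v = Semistab" for u v
    using assms(2) that by (auto simp: adjacency_conditions_def)
  have ss: "Semistab \<in> \<mu> ` pverts G \<Longrightarrow> Stab \<in> \<mu> ` pverts G"
    using assms(2) by (auto simp: adjacency_conditions_def)
  have sub: "u \<in> pverts G" "v \<in> pverts G" if "(u, v) \<in> parcs G" for u v
    using that arc_fst_in_verts arc_snd_in_verts by fastforce+
  let ?M = "\<mu> ` pverts G" and ?E = "map_prod \<mu> \<mu> ` parcs G"
  have conn: "(Unstab, Stab) \<in> ?E \<or> (Unstab, Semistab) \<in> ?E" if M: "Unstab \<in> ?M" "Stab \<in> ?M"
  proof -
    obtain u v where uv: "u \<in> pverts G" "\<mu> u = Unstab" "v \<in> pverts G" "\<mu> v = Stab"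
      using M by force
    then have "u \<noteq> v" by auto
    then obtain w where w: "w \<noteq> u" "(u, w) \<in> parcs G \<or> (w, u) \<in> parcs G"
      using connected_imp_incident_arc[OF con uv(1,3)] by blast
    then have uw: "(u, w) \<in> parcs G" using un uv(2) by blast
    then have "\<mu> w \<noteq> Unstab" using w(1) un by blast
    moreover have "(Unstab, \<mu> w) \<in> ?E" using uw uv(2) by force
    ultimately show ?thesis by (cases "\<mu> w") auto
  qed
  obtain S where "stability_theory S" "\<And>i. stratum S i \<noteq> {} \<longleftrightarrow> i \<in> ?M"
      "\<And>i j. touches S i j \<longleftrightarrow> (i, j) \<in> ?E"
  proof (rule realize_adjacency[of ?E ?M])
    show "?E \<subseteq> ?M \<times> ?M" using sub by auto
    show "(i, i) \<in> ?E" if "i \<in> ?M" for i using that loops by force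
    show "i = Unstab" if "(i, Unstab) \<in> ?E" for i using that un by force
    show "(Stab, Semistab) \<in> ?E" if "Stab \<in> ?M" "Semistab \<in> ?M"
      using that s_ss by (force simp: image_iff)
  qed (use ne ss conn in auto)
  then show ?thesis
    using marked_digraph_iso_adjI[OF pair_wf_digraph_axioms inj] by blast
qed

theorem proposition14:
  fixes G :: "'v pair_pre_digraph" and \<mu> :: "'v \<Rightarrow> mark"
  shows "(marked_digraph G \<mu> \<and> adjacency_conditions G \<mu> \<longrightarrow>
            (\<exists>S. stability_theory S \<and> marked_digraph_iso G \<mu> (adj S) (adj_mark S))) \<and>
         (\<forall>S. stability_theory S \<longrightarrow>
            marked_digraph (adj S) (adj_mark S) \<and> adjacency_conditions (adj S) (adj_mark S))"
  using conditions_imp_realizable adj_satisfies_conditions by blast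

end
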